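(* Let $m\ge 1$ be an integer and let $(x_k)_{k\ge 0}$ be generated by Anderson acceleration AA($m$) from an initial guess $x_0\in\mathbb{R}^n$, applied to the linear fixed-point function $q(x)=Mx+b$, with acceleration coefficients $\beta_i^{(k)}$ and residuals $r_k=x_k-q(x_k)$. Then AA($m$) is a Krylov method, with the residuals given by $$ r_{k+1}=p_{k+1}(M)\,r_0,\qquad k\ge 0, $$ where $p_{k+1}(\lambda)$ is a polynomial of degree at most $k+1$, and these polynomials satisfy the following recurrence relations, with $p_0(\lambda)=1$. When $k=0$, $p_1(\lambda)=\lambda$. When $1\le k<m$, $$ p_{k+1}(\lambda)=\Big(1+\sum_{i=1}^{k}\beta_i^{(k)}\Big)\lambda\, p_k(\lambda)-\sum_{i=1}^{k}\beta_i^{(k)}\lambda\, p_{k-i}(\lambda). $$ When $k\ge m$, $$ p_{k+1}(\lambda)=\Big(1+\sum_{i=1}^{m}\beta_i^{(k)}\Big)\lambda\, p_k(\lambda)-\sum_{i=1}^{m}\beta_i^{(k)}\lambda\, p_{k-i}(\lambda). $$ Moreover, $p_k(1)=1$ and $p_k(0)=0$ for $k=1,2,\ldots$.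
   Context: Setting: $M\in\mathbb{R}^{n\times n}$, $b\in\mathbb{R}^n$, $q(x)=Mx+b$, $A=I-M$ is nonsingular and $M\neq 0$. $\|\cdot\|$ is the 2-norm. The residual is $r(x)=x-q(x)=Ax-b$ and $r_k=r(x_k)$. AA($m$) with finite window size $m$: given $x_0\in\mathbb{R}^n$, for $k=0,1,2,\ldots$, with $m_k=\min(k,m)$, $$x_{k+1}=q(x_k)+\sum_{i=1}^{m_k}\beta_i^{(k)}\big(q(x_k)-q(x_{k-i})\big)$$ (so $x_1=q(x_0)$). The coefficient vector $\boldsymbol\beta^{(k)}=(\beta_1^{(k)},\ldots,\beta_{m_k}^{(k)})^T$ is the minimum-norm minimizer of $\|r_k+\sum_{i=1}^{m_k}\beta_i(r_k-r_{k-i})\|^2$, i.e. $\boldsymbol\beta^{(k)}=-R_k^{\dagger}r_k$ with $R_k=[\,r_k-r_{k-1}\ \cdots\ r_k-r_{k-m_k}\,]$ and $\dagger$ the pseudo-inverse; it equals $-(R_k^TR_k)^{-1}R_k^Tr_k$ if $R_k^TR_k$ is invertible. The Krylov subspace is $\mathcal{K}_s(T,v)=\mathrm{span}\{v,Tv,\ldots,T^{s-1}v\}$; "Krylov method" means $r_{k+1}\in\mathcal{K}_{s}(M,r_0)$ for suitable $s$ (here $s=k+2$). *)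

theory Defs
  imports "HOL-Analysis.Analysis" "HOL-Computational_Algebra.Polynomial"
begin

text \<open>The ring operations that the library provides on \<^typ>\<open>real^'n^'n\<close> are componentwise,
  so neither \<open>^\<close> nor \<^const>\<open>poly\<close> gives powers and polynomials with respect to the matrix
  product.\<close>

primrec matrix_power :: "real^'n^'n \<Rightarrow> nat \<Rightarrow> real^'n^'n" where
  "matrix_power T 0 = mat 1"
| "matrix_power T (Suc j) = T ** matrix_power T j"

definition matrix_poly :: "real poly \<Rightarrow> real^'n^'n \<Rightarrow> real^'n^'n" where
  "matrix_poly p T = (\<Sum>j\<le>degree p. coeff p j *\<^sub>R matrix_power T j)"

definition krylov :: "nat \<Rightarrow> real^'n^'n \<Rightarrow> real^'n \<Rightarrow> (real^'n) set" where
  "krylov s T v = span {matrix_power T j *v v | j. j < s}"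

definition fixed_point_map :: "real^'n^'n \<Rightarrow> real^'n \<Rightarrow> real^'n \<Rightarrow> real^'n" where
  "fixed_point_map M b y = M *v y + b"

definition residual :: "real^'n^'n \<Rightarrow> real^'n \<Rightarrow> real^'n \<Rightarrow> real^'n" where
  "residual M b y = y - fixed_point_map M b y"

text \<open>A coefficient vector \<open>(\<beta>\<^sub>1, \<dots>, \<beta>\<^sub>l)\<close> is a function on \<^typ>\<open>nat\<close> of which only the values on
  \<open>{1..l}\<close> matter; its 2-norm is \<open>L2_set \<beta> {1..l}\<close>.\<close>

definition lsq_objective ::
    "(nat \<Rightarrow> real^'n) \<Rightarrow> nat \<Rightarrow> nat \<Rightarrow> (nat \<Rightarrow> real) \<Rightarrow> real" where
  "lsq_objective r k l \<beta> = (norm (r k + (\<Sum>i=1..l. \<beta> i *\<^sub>R (r k - r (k - i)))))\<^sup>2"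

definition lsq_minimizer ::
    "(nat \<Rightarrow> real^'n) \<Rightarrow> nat \<Rightarrow> nat \<Rightarrow> (nat \<Rightarrow> real) \<Rightarrow> bool" where
  "lsq_minimizer r k l \<beta> \<longleftrightarrow> (\<forall>\<gamma>. lsq_objective r k l \<beta> \<le> lsq_objective r k l \<gamma>)"

definition min_norm_lsq_minimizer ::
    "(nat \<Rightarrow> real^'n) \<Rightarrow> nat \<Rightarrow> nat \<Rightarrow> (nat \<Rightarrow> real) \<Rightarrow> bool" where
  "min_norm_lsq_minimizer r k l \<beta> \<longleftrightarrow> lsq_minimizer r k l \<beta> \<and>
     (\<forall>\<gamma>. lsq_minimizer r k l \<gamma> \<longrightarrow> L2_set \<beta> {1..l} \<le> L2_set \<gamma> {1..l})"

text \<open>\<open>anderson m M b x0 x \<beta>\<close>: the iterates \<open>x\<close> and the coefficients \<open>\<beta> k i\<close> (written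
  \<open>\<beta>\<^sub>i\<close> at step \<open>k\<close>) are those of AA(m) for \<open>q(y) = M y + b\<close>, started at \<open>x0\<close>. The minimum-norm
  least-squares solution is unique, so this determines \<open>x\<close>, and \<open>\<beta> k i\<close> for
  \<open>1 \<le> i \<le> min k m\<close>.\<close>

definition anderson ::
    "nat \<Rightarrow> real^'n^'n \<Rightarrow> real^'n \<Rightarrow> real^'n \<Rightarrow> (nat \<Rightarrow> real^'n) \<Rightarrow> (nat \<Rightarrow> nat \<Rightarrow> real) \<Rightarrow> bool" where
  "anderson m M b x0 x \<beta> \<longleftrightarrow>
     x 0 = x0 \<and>
     (\<forall>k. min_norm_lsq_minimizer (\<lambda>j. residual M b (x j)) k (min k m) (\<beta> k)) \<and>
     (\<forall>k. x (Suc k) = fixed_point_map M b (x k) +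
        (\<Sum>i=1..min k m. \<beta> k i *\<^sub>R (fixed_point_map M b (x k) - fixed_point_map M b (x (k - i)))))"

end

theory Submission
  imports Defs
begin

text \<open>Write \<open>r\<^sub>k\<close> for the residuals. The residual map \<open>y \<mapsto> (I - M) y - b\<close> is affine and it
  intertwines with one Picard step: the residual of \<open>q(y)\<close> is \<open>M\<close> times the residual of \<open>y\<close>.
  The Anderson iterate is an affine combination, with weights adding up to one, of the points
  \<open>q(x\<^sub>k), \<dots>, q(x\<^sub>k\<^sub>-\<^sub>l)\<close>, where \<open>l = min k m\<close>. Affine maps respect such combinations, hence
  \[ r_{k+1} = M \bigl(r_k + \sum_{i=1}^{l} \beta^{(k)}_i (r_k - r_{k-i})\bigr) \]
  (lemma \<open>anderson_residual_Suc\<close>).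

  Replacing \<open>M\<close> by an indeterminate \<open>\<lambda>\<close> and \<open>r\<^sub>0\<close> by \<open>1\<close> turns this recurrence into the
  definition of the polynomials \<open>p\<^sub>k\<close> (\<open>residual_poly\<close> below). Evaluation
  \<open>p \<mapsto> p(M) r\<^sub>0\<close> is linear and takes multiplication by \<open>\<lambda>\<close> to application of \<open>M\<close>, so it maps
  \<open>p\<^sub>k\<close> to \<open>r\<^sub>k\<close> for all \<open>k\<close>. The remaining claims can be read off the same form of the
  recurrence: the factor \<open>\<lambda>\<close> raises the degree by at most one and gives the zero at \<open>0\<close>, and
  at \<open>\<lambda> = 1\<close> all differences \<open>p\<^sub>k - p\<^sub>k\<^sub>-\<^sub>i\<close> vanish by induction, so the value \<open>p\<^sub>0(1) = 1\<close>
  is handed on. The degree bound puts \<open>r\<^sub>k\<^sub>+\<^sub>1\<close> into the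
  Krylov space.\<close>

section \<open>Polynomials of a matrix\<close>

text \<open>The degree in the definition of \<^const>\<open>matrix_poly\<close> is awkward for sums of polynomials,
  where it can drop; a free upper bound makes evaluation visibly linear.\<close>

lemma matrix_poly_eq_sum:
  assumes "degree p \<le> n"
  shows "matrix_poly p T = (\<Sum>j\<le>n. coeff p j *\<^sub>R matrix_power T j)"
  unfolding matrix_poly_def
  using assms by (intro sum.mono_neutral_left) (auto simp: coeff_eq_0)

lemma matrix_poly_0 [simp]: "matrix_poly 0 T = 0"
  by (simp add: matrix_poly_def)

lemma matrix_poly_1 [simp]: "matrix_poly 1 T = mat 1"
  by (simp add: matrix_poly_def)

lemma matrix_poly_add: "matrix_poly (p + q) T = matrix_poly p T + matrix_poly q T"
proof -
  define n where "n = max (degree p) (degree q)"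
  have "degree (p + q) \<le> n" "degree p \<le> n" "degree q \<le> n"
    by (auto simp: n_def degree_add_le)
  then show ?thesis
    by (simp add: matrix_poly_eq_sum scaleR_add_left sum.distrib)
qed

lemma matrix_poly_smult: "matrix_poly (smult c p) T = c *\<^sub>R matrix_poly p T"
  by (simp add: matrix_poly_eq_sum[OF degree_smult_le] matrix_poly_def scaleR_sum_right)

lemma matrix_poly_diff: "matrix_poly (p - q) T = matrix_poly p T - matrix_poly q T"
  using matrix_poly_add[of p "smult (- 1) q" T] matrix_poly_smult[of "- 1" q T] by simp

lemma matrix_poly_sum: "matrix_poly (\<Sum>i\<in>I. f i) T = (\<Sum>i\<in>I. matrix_poly (f i) T)"
  by (induction I rule: infinite_finite_induct) (simp_all add: matrix_poly_add)

lemma matrix_mult_sum_right: "T ** (\<Sum>i\<in>I. A i) = (\<Sum>i\<in>I. T ** A i)"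
  for T :: "real^'n^'n" and A :: "'i \<Rightarrow> real^'n^'n"
  by (induction I rule: infinite_finite_induct) (simp_all add: matrix_add_ldistrib)

lemma matrix_poly_pCons_0: "matrix_poly (pCons 0 p) T = T ** matrix_poly p T"
proof -
  have "matrix_poly (pCons 0 p) T
      = (\<Sum>j\<le>Suc (degree p). coeff (pCons 0 p) j *\<^sub>R matrix_power T j)"
    by (rule matrix_poly_eq_sum) (rule degree_pCons_le)
  also have "\<dots> = (\<Sum>j\<le>degree p. coeff p j *\<^sub>R (T ** matrix_power T j))"
    by (subst sum.atMost_Suc_shift) simp
  also have "\<dots> = T ** matrix_poly p T"
    by (simp add: matrix_poly_def matrix_mult_sum_right
        matrix_scalar_ac scalar_matrix_assoc[symmetric])
  finally show ?thesis .
qed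

lemma sum_matrix_vector_mult: "(\<Sum>i\<in>I. A i) *v v = (\<Sum>i\<in>I. A i *v v)"
  for A :: "'i \<Rightarrow> real^'n^'n"
  by (induction I rule: infinite_finite_induct) (simp_all add: matrix_vector_mult_add_rdistrib)

lemma matrix_poly_mult_vec_in_krylov:
  assumes "degree p < s"
  shows "matrix_poly p T *v v \<in> krylov s T v"
proof -
  have "matrix_poly p T *v v = (\<Sum>j\<le>degree p. coeff p j *\<^sub>R (matrix_power T j *v v))"
    by (simp add: matrix_poly_def sum_matrix_vector_mult scaleR_matrix_vector_assoc[symmetric])
  also have "\<dots> \<in> krylov s T v"
    unfolding krylov_def using assms
    by (intro span_sum span_scale span_base) auto
  finally show ?thesis .
qed

section \<open>The residual recurrence\<close>

text \<open>The argument on the left is the affine combination of \<open>y\<close> and the \<open>z i\<close> with weights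
  \<open>1 + \<Sum> c\<close> and \<open>- c i\<close>. The constant \<open>b\<close> cancels in each difference, so only the linear
  part \<open>I - M\<close> acts on the correction.\<close>

lemma residual_affine_combination:
  "residual M b (y + (\<Sum>i\<in>I. c i *\<^sub>R (y - z i)))
    = residual M b y + (\<Sum>i\<in>I. c i *\<^sub>R (residual M b y - residual M b (z i)))"
proof -
  let ?d = "\<Sum>i\<in>I. c i *\<^sub>R (y - z i)"
  have "residual M b (y + ?d) = residual M b y + (?d - M *v ?d)"
    by (simp add: residual_def fixed_point_map_def matrix_vector_right_distrib)
  also have "?d - M *v ?d = (\<Sum>i\<in>I. c i *\<^sub>R ((y - z i) - M *v (y - z i)))"
    by (simp add: linear_sum[OF matrix_vector_mul_linear] matrix_vector_mult_scaleR
        sum_subtractf[symmetric] scaleR_diff_right[symmetric])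
  also have "\<dots> = (\<Sum>i\<in>I. c i *\<^sub>R (residual M b y - residual M b (z i)))"
    by (intro sum.cong)
       (simp_all add: residual_def fixed_point_map_def matrix_vector_mult_diff_distrib)
  finally show ?thesis .
qed

lemma residual_fixed_point_map: "residual M b (fixed_point_map M b y) = M *v residual M b y"
  by (simp add: residual_def fixed_point_map_def matrix_vector_mult_diff_distrib
      matrix_vector_right_distrib)

lemma anderson_residual_Suc:
  assumes "anderson m M b x0 x \<beta>" and r: "\<And>k. r k = residual M b (x k)"
  shows "r (Suc k) = M *v (r k + (\<Sum>i=1..min k m. \<beta> k i *\<^sub>R (r k - r (k - i))))"
proof -
  have "x (Suc k) = fixed_point_map M b (x k) + (\<Sum>i=1..min k m.
      \<beta> k i *\<^sub>R (fixed_point_map M b (x k) - fixed_point_map M b (x (k - i))))"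
    using assms(1) by (simp add: anderson_def)
  then have "r (Suc k) = M *v r k + (\<Sum>i=1..min k m. \<beta> k i *\<^sub>R (M *v r k - M *v r (k - i)))"
    by (simp add: r residual_affine_combination residual_fixed_point_map)
  then show ?thesis
    by (simp add: matrix_vector_right_distrib linear_sum[OF matrix_vector_mul_linear]
        matrix_vector_mult_scaleR matrix_vector_mult_diff_distrib)
qed

section \<open>The residual polynomials\<close>

text \<open>The form with differences and a single outer factor \<open>\<lambda>\<close> (the \<open>pCons 0\<close>) copies
  \<open>anderson_residual_Suc\<close> term by term, and displays the values at \<open>0\<close> and \<open>1\<close>.
  One recursion with window \<open>min k m\<close> covers both the growing and the full window.\<close>

fun residual_poly :: "nat \<Rightarrow> (nat \<Rightarrow> nat \<Rightarrow> real) \<Rightarrow> nat \<Rightarrow> real poly" where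
  "residual_poly m \<beta> 0 = 1"
| "residual_poly m \<beta> (Suc k) = pCons 0 (residual_poly m \<beta> k +
     (\<Sum>i=1..min k m. smult (\<beta> k i) (residual_poly m \<beta> k - residual_poly m \<beta> (k - i))))"

declare residual_poly.simps(2) [simp del]

text \<open>Collecting the multiples of the newest polynomial turns the differences into the classical
  recurrence, in which \<open>p\<^sub>k\<close> carries the coefficient \<open>1 + \<Sum> \<beta>\<close>.\<close>

lemma residual_poly_Suc:
  "residual_poly m \<beta> (Suc k) =
     smult (1 + (\<Sum>i=1..min k m. \<beta> k i)) ([:0, 1:] * residual_poly m \<beta> k)
     - (\<Sum>i=1..min k m. smult (\<beta> k i) ([:0, 1:] * residual_poly m \<beta> (k - i)))"
proof -
  have "residual_poly m \<beta> (Suc k) = [:0, 1:] * (residual_poly m \<beta> k +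
     (\<Sum>i=1..min k m. smult (\<beta> k i) (residual_poly m \<beta> k - residual_poly m \<beta> (k - i))))"
    by (simp add: residual_poly.simps(2))
  also have "\<dots> = smult (1 + (\<Sum>i=1..min k m. \<beta> k i)) ([:0, 1:] * residual_poly m \<beta> k)
     - (\<Sum>i=1..min k m. smult (\<beta> k i) ([:0, 1:] * residual_poly m \<beta> (k - i)))"
    by (simp only: smult_diff_right sum_subtractf smult_sum[symmetric] smult_add_left
        smult_1_left distrib_left right_diff_distrib sum_distrib_left mult_smult_right
        add_diff_eq)
  finally show ?thesis .
qed

lemma degree_residual_poly: "degree (residual_poly m \<beta> k) \<le> k"
proof (induction k rule: less_induct)
  case (less k)
  show ?case
  proof (cases k)
    case (Suc j)
    have IH: "degree (residual_poly m \<beta> (j - i)) \<le> j" for i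
      using less.IH[of "j - i"] Suc by linarith
    have "degree (residual_poly m \<beta> j +
        (\<Sum>i=1..min j m. smult (\<beta> j i) (residual_poly m \<beta> j - residual_poly m \<beta> (j - i)))) \<le> j"
      using IH[of 0] IH
      by (intro degree_add_le degree_sum_le order.trans[OF degree_smult_le] degree_diff_le) auto
    then show ?thesis
      unfolding Suc residual_poly.simps(2) by (meson degree_pCons_le le_trans Suc_le_mono)
  qed simp
qed

lemma poly_residual_poly_0: "k \<ge> 1 \<Longrightarrow> poly (residual_poly m \<beta> k) 0 = 0"
  by (cases k) (simp_all add: residual_poly.simps(2))

lemma poly_residual_poly_1: "poly (residual_poly m \<beta> k) 1 = 1"
proof (induction k rule: less_induct)
  case (less k)
  then show ?case
    by (cases k) (simp_all add: residual_poly.simps(2) poly_sum)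
qed

text \<open>Both sides obey the same recurrence, because evaluation at \<open>M\<close> followed by application
  to \<open>r 0\<close> is linear and turns \<open>pCons 0\<close> into \<open>M *v\<close>.\<close>

lemma anderson_residual_eq_residual_poly:
  assumes "anderson m M b x0 x \<beta>" and "\<And>k. r k = residual M b (x k)"
  shows "r k = matrix_poly (residual_poly m \<beta> k) M *v r 0"
proof (induction k rule: less_induct)
  case (less k)
  show ?case
  proof (cases k)
    case 0
    then show ?thesis by simp
  next
    case (Suc j)
    let ?E = "\<lambda>p. matrix_poly p M *v r 0"
    let ?p = "residual_poly m \<beta>"
    have IH: "r (j - i) = ?E (?p (j - i))" for i
      using less.IH[of "j - i"] Suc by simp
    have "?E (?p (Suc j)) =
        M *v (?E (?p j) + (\<Sum>i=1..min j m. \<beta> j i *\<^sub>R (?E (?p j) - ?E (?p (j - i)))))"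
      by (simp add: residual_poly.simps(2) matrix_poly_pCons_0 matrix_poly_add matrix_poly_sum
          matrix_poly_smult matrix_poly_diff matrix_vector_mul_assoc[symmetric]
          matrix_vector_mult_add_rdistrib matrix_vector_mult_diff_rdistrib
          sum_matrix_vector_mult scaleR_matrix_vector_assoc[symmetric])
    also have "\<dots> = M *v (r j + (\<Sum>i=1..min j m. \<beta> j i *\<^sub>R (r j - r (j - i))))"
      using IH[of 0] by (simp add: IH[symmetric])
    also have "\<dots> = r (Suc j)"
      using anderson_residual_Suc[OF assms] by simp
    finally show ?thesis
      using Suc by simp
  qed
qed

section \<open>Anderson acceleration is a Krylov method\<close>

theorem proposition2p2:
  fixes M :: "real^'n^'n" and b x0 :: "real^'n" and m :: nat
    and x r :: "nat \<Rightarrow> real^'n" and \<beta> :: "nat \<Rightarrow> nat \<Rightarrow> real"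
  assumes "invertible (mat 1 - M)" and "M \<noteq> 0" and "m \<ge> 1"
    and "anderson m M b x0 x \<beta>"
    and "\<And>k. r k = residual M b (x k)"
  shows "(\<forall>k. r (k + 1) \<in> krylov (k + 2) M (r 0)) \<and>
    (\<exists>p :: nat \<Rightarrow> real poly.
      (\<forall>k. r (k + 1) = matrix_poly (p (k + 1)) M *v r 0) \<and>
      (\<forall>k. degree (p (k + 1)) \<le> k + 1) \<and>
      p 0 = 1 \<and>
      p 1 = [:0, 1:] \<and>
      (\<forall>k. 1 \<le> k \<and> k < m \<longrightarrow>
        p (k + 1) = smult (1 + (\<Sum>i=1..k. \<beta> k i)) ([:0, 1:] * p k)
                    - (\<Sum>i=1..k. smult (\<beta> k i) ([:0, 1:] * p (k - i)))) \<and>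
      (\<forall>k. k \<ge> m \<longrightarrow>
        p (k + 1) = smult (1 + (\<Sum>i=1..m. \<beta> k i)) ([:0, 1:] * p k)
                    - (\<Sum>i=1..m. smult (\<beta> k i) ([:0, 1:] * p (k - i)))) \<and>
      (\<forall>k. k \<ge> 1 \<longrightarrow> poly (p k) 1 = 1 \<and> poly (p k) 0 = 0))"
proof -
  let ?p = "residual_poly m \<beta>"
  have eval: "r k = matrix_poly (?p k) M *v r 0" for k
    using assms(4,5) by (rule anderson_residual_eq_residual_poly)
  have deg: "degree (?p k) \<le> k" for k
    by (rule degree_residual_poly)
  have "r (k + 1) \<in> krylov (k + 2) M (r 0)" for k
    unfolding eval[of "k + 1"]
    by (rule matrix_poly_mult_vec_in_krylov) (use deg[of "k + 1"] in linarith)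
  moreover have "?p 1 = [:0, 1:]"
    using residual_poly_Suc[of m \<beta> 0] by simp
  moreover have "?p (k + 1) = smult (1 + (\<Sum>i=1..k. \<beta> k i)) ([:0, 1:] * ?p k)
      - (\<Sum>i=1..k. smult (\<beta> k i) ([:0, 1:] * ?p (k - i)))" if "k < m" for k
    using residual_poly_Suc[of m \<beta> k] that by (simp add: min_absorb1)
  moreover have "?p (k + 1) = smult (1 + (\<Sum>i=1..m. \<beta> k i)) ([:0, 1:] * ?p k)
      - (\<Sum>i=1..m. smult (\<beta> k i) ([:0, 1:] * ?p (k - i)))" if "k \<ge> m" for k
    using residual_poly_Suc[of m \<beta> k] that by (simp add: min_absorb2)
  ultimately show ?thesis
    by (intro conjI allI exI[of _ ?p] impI)
       (rule eval deg residual_poly.simps(1) poly_residual_poly_0 poly_residual_poly_1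
        | assumption | blast)+
qed

end
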